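(* Consider the system $$u_{xt}+uu_{xx}=u_x^2-b_x^2+bb_{xx}+2\|b_x\|_2^2-2\|u_x\|_2^2,\qquad b_t+ub_x=bu_x,$$ for $0\le x\le1$, describing solutions of the form $\boldsymbol{u}(x,y,t)=(u(x,t),-yu_x(x,t))$, $\boldsymbol{b}(x,y,t)=(b(x,t),-yb_x(x,t))$ of the 2D ideal MHD equations, under the Dirichlet boundary condition $u(0,t)=u(1,t)=0$, $b(0,t)=b(1,t)=0$ and smooth initial data $(u_0(x),b_0(x))$. Moreover, let $U_0(x)=x(1-x)$ be the initial data of the associated 2D Euler equation $$U_{xt}+UU_{xx}=U_x^2-2\|U_x(\cdot,t)\|_2^2,$$ whose solution $U(x,t)$ satisfies the Dirichlet boundary condition $U(0,t)=U(1,t)=0$ and has finite interval of existence $\mathcal{I}_e=(0,T_e)$ for $T_e=\pi^2/6$; more precisely, $$\lim_{t\nearrow T_e}U_x(0,t)=\lim_{t\nearrow T_e}\|U_x(\cdot,t)\|_2=\infty.$$ Lastly, suppose $u_0$ and $b_0$ are such that $$b_0'(0)=0,\qquad u_0'(0)\ge U_0'(0),\qquad\text{and}\qquad \|U_0'\|_2^2\ge\|u_0'\|_2^2-\|b_0'\|_2^2.$$ If $$\|U_x(\cdot,t)\|_2^2\ge\|u_x(\cdot,t)\|_2^2-\|b_x(\cdot,t)\|_2^2$$ for all $t\in\mathcal{I}_e$, then $$\lim_{t\nearrow T_e}u_x(0,t)=\infty.$$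
   Context: Here $\|\cdot\|_2=\|\cdot\|_{L^2([0,1])}$ in the variable $x$. The 2D ideal MHD equations are $\boldsymbol{u}_t+\boldsymbol{u}\cdot\nabla\boldsymbol{u}=-\nabla p+\boldsymbol{b}\cdot\nabla\boldsymbol{b}$, $\boldsymbol{b}_t+\boldsymbol{u}\cdot\nabla\boldsymbol{b}=\boldsymbol{b}\cdot\nabla\boldsymbol{u}$, $\nabla\cdot\boldsymbol{u}=\nabla\cdot\boldsymbol{b}=0$. The blowup of $U$ at time $T_e=\pi^2/6$ is a known fact from earlier literature, taken as given in the statement. *)

theory Defs
  imports "HOL-Analysis.Analysis"
begin

text \<open>Functions of space and time are written \<open>f x t\<close>. Only their values for
  \<open>x \<in> {0..1}\<close> and \<open>t \<in> {0..<T}\<close> matter; accordingly, the spatial derivatives are one-sided at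
  \<open>x = 0\<close> and \<open>x = 1\<close>.\<close>

definition deriv01 :: "(real \<Rightarrow> real) \<Rightarrow> real \<Rightarrow> real" where
  "deriv01 f x = vector_derivative f (at x within {0..1})"

definition smooth01 :: "(real \<Rightarrow> real) \<Rightarrow> bool" where
  "smooth01 f \<longleftrightarrow> (\<forall>n. (deriv01 ^^ n) f differentiable_on {0..1})"

definition dx :: "(real \<Rightarrow> real \<Rightarrow> real) \<Rightarrow> real \<Rightarrow> real \<Rightarrow> real" where
  "dx f x t = deriv01 (\<lambda>\<xi>. f \<xi> t) x"

definition dt :: "(real \<Rightarrow> real \<Rightarrow> real) \<Rightarrow> real \<Rightarrow> real \<Rightarrow> real" where
  "dt f x t = deriv (\<lambda>s. f x s) t"

definition L2norm01 :: "(real \<Rightarrow> real) \<Rightarrow> real" where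
  "L2norm01 f = sqrt (integral {0..1} (\<lambda>x. (f x)\<^sup>2))"

text \<open>Regularity of classical solutions: exactly the derivatives occurring in the equations are
  required to exist and to be continuous. The second-order and the time derivatives are
  considered for positive times only, while \<open>f\<close> and \<open>dx f\<close> are continuous up to \<open>t = 0\<close>, so that
  the initial data are attained in \<open>C\<^sup>1\<close>. Every solution that is smooth on
  \<open>{0..1} \<times> {0..<T}\<close> is covered.\<close>

definition space_regular :: "real \<Rightarrow> (real \<Rightarrow> real \<Rightarrow> real) \<Rightarrow> bool" where
  "space_regular T f \<longleftrightarrow>
     (\<forall>t\<in>{0..<T}. (\<lambda>x. f x t) differentiable_on {0..1}) \<and>
     (\<forall>t\<in>{0<..<T}. (\<lambda>x. dx f x t) differentiable_on {0..1}) \<and>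
     continuous_on ({0..1} \<times> {0..<T}) (\<lambda>(x, t). f x t) \<and>
     continuous_on ({0..1} \<times> {0..<T}) (\<lambda>(x, t). dx f x t) \<and>
     continuous_on ({0..1} \<times> {0<..<T}) (\<lambda>(x, t). dx (dx f) x t)"

definition time_regular :: "real \<Rightarrow> (real \<Rightarrow> real \<Rightarrow> real) \<Rightarrow> bool" where
  "time_regular T f \<longleftrightarrow>
     (\<forall>x\<in>{0..1}. \<forall>t\<in>{0<..<T}. (\<lambda>s. f x s) differentiable (at t)) \<and>
     continuous_on ({0..1} \<times> {0<..<T}) (\<lambda>(x, t). dt f x t)"

definition dirichlet :: "real \<Rightarrow> (real \<Rightarrow> real \<Rightarrow> real) \<Rightarrow> bool" where
  "dirichlet T f \<longleftrightarrow> (\<forall>t\<in>{0..<T}. f 0 t = 0 \<and> f 1 t = 0)"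

definition mhd_solution ::
  "real \<Rightarrow> (real \<Rightarrow> real) \<Rightarrow> (real \<Rightarrow> real) \<Rightarrow> (real \<Rightarrow> real \<Rightarrow> real) \<Rightarrow> (real \<Rightarrow> real \<Rightarrow> real) \<Rightarrow> bool" where
  "mhd_solution T u0 b0 u b \<longleftrightarrow>
     space_regular T u \<and> time_regular T (dx u) \<and>
     space_regular T b \<and> time_regular T b \<and>
     (\<forall>x\<in>{0..1}. \<forall>t\<in>{0<..<T}.
        dt (dx u) x t + u x t * dx (dx u) x t =
          (dx u x t)\<^sup>2 - (dx b x t)\<^sup>2 + b x t * dx (dx b) x t
          + 2 * (L2norm01 (\<lambda>\<xi>. dx b \<xi> t))\<^sup>2 - 2 * (L2norm01 (\<lambda>\<xi>. dx u \<xi> t))\<^sup>2 \<and>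
        dt b x t + u x t * dx b x t = b x t * dx u x t) \<and>
     dirichlet T u \<and> dirichlet T b \<and>
     (\<forall>x\<in>{0..1}. u x 0 = u0 x \<and> b x 0 = b0 x)"

definition euler_solution ::
  "real \<Rightarrow> (real \<Rightarrow> real) \<Rightarrow> (real \<Rightarrow> real \<Rightarrow> real) \<Rightarrow> bool" where
  "euler_solution T U0 U \<longleftrightarrow>
     space_regular T U \<and> time_regular T (dx U) \<and>
     (\<forall>x\<in>{0..1}. \<forall>t\<in>{0<..<T}.
        dt (dx U) x t + U x t * dx (dx U) x t =
          (dx U x t)\<^sup>2 - 2 * (L2norm01 (\<lambda>\<xi>. dx U \<xi> t))\<^sup>2) \<and>
     dirichlet T U \<and>
     (\<forall>x\<in>{0..1}. U x 0 = U0 x)"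

definition U_init :: "real \<Rightarrow> real" where
  "U_init x = x * (1 - x)"

definition T_e :: real where
  "T_e = pi\<^sup>2 / 6"

end

theory Submission
  imports Defs
begin

text \<open>
  At the wall \<open>x = 0\<close> the two partial differential equations reduce to ordinary ones, and these are
  compared. Write \<open>f t = dx u 0 t\<close>, \<open>F t = dx U 0 t\<close> and \<open>\<beta> t = dx b 0 t\<close>. Since \<open>u\<close>, \<open>b\<close> and \<open>U\<close>
  vanish at \<open>x = 0\<close>, so do the terms with second derivatives, and
  \<open>f' - F' = (f + F) (f - F) - \<beta>\<^sup>2 + 2 (\<parallel>U\<^sub>x\<parallel>\<^sup>2 - \<parallel>u\<^sub>x\<parallel>\<^sup>2 + \<parallel>b\<^sub>x\<parallel>\<^sup>2)\<close>.

  The only negative contribution is \<open>-\<beta>\<^sup>2\<close>, and it is absent: formally, differentiating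
  \<open>b\<^sub>t = b u\<^sub>x - u b\<^sub>x\<close> in \<open>x\<close> and putting \<open>x = 0\<close> gives \<open>\<beta>' = \<beta> f - f \<beta> = 0\<close>, so that \<open>\<beta>\<close> keeps its
  initial value \<open>0\<close>. The mixed derivative \<open>b\<^sub>x\<^sub>t\<close> need not exist, however; lemma
  \<open>wall_slope_constant\<close> obtains the conservation of \<open>\<beta>\<close> from the difference quotients \<open>b / x\<close>.

  By the assumed comparison of norms, \<open>w = f - F\<close> therefore satisfies \<open>w' \<ge> (f + F) w\<close> with
  \<open>w 0 \<ge> 0\<close>, and an integrating factor (lemma \<open>linear_differential_inequality_nonneg\<close>) yields
  \<open>f \<ge> F\<close> up to \<open>T_e\<close>. The blowup of \<open>F\<close> carries over to \<open>f\<close>.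
\<close>

lemma dx_has_real_derivative:
  assumes "space_regular T f" "t \<in> {0..<T}" "x \<in> {0..1}"
  shows "((\<lambda>\<xi>. f \<xi> t) has_real_derivative dx f x t) (at x within {0..1})"
proof -
  have "(\<lambda>\<xi>. f \<xi> t) differentiable (at x within {0..1})"
    using assms unfolding space_regular_def differentiable_on_def by blast
  then show ?thesis
    unfolding dx_def deriv01_def has_real_derivative_iff_has_vector_derivative
    using vector_derivative_works by blast
qed

lemma dx_continuous_on:
  assumes "space_regular T f"
  shows "continuous_on ({0..1} \<times> {0..<T}) (\<lambda>(x, t). dx f x t)"
  using assms by (simp add: space_regular_def)

lemma dx_continuous_in_time:
  assumes "space_regular T f" "x \<in> {0..1}"
  shows "continuous_on {0..<T} (dx f x)"
proof -
  have "continuous_on {0..<T} ((\<lambda>(x, t). dx f x t) \<circ> (\<lambda>t. (x, t)))"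
    by (intro continuous_on_compose continuous_intros
        continuous_on_subset[OF dx_continuous_on[OF assms(1)]]) (use assms in auto)
  then show ?thesis by (simp add: o_def)
qed

lemma dt_has_real_derivative:
  assumes "time_regular T f" "x \<in> {0..1}" "t \<in> {0<..<T}"
  shows "(f x has_real_derivative dt f x t) (at t)"
proof -
  have "f x differentiable (at t)"
    using assms unfolding time_regular_def by auto
  then show ?thesis
    unfolding dt_def by (simp add: DERIV_deriv_iff_real_differentiable)
qed

lemma wall_mean_value:
  assumes "space_regular T f" "t \<in> {0..<T}" "f 0 t = 0" "0 < x" "x \<le> 1"
  obtains \<xi> where "0 \<le> \<xi>" "\<xi> \<le> x" "f x t = x * dx f \<xi> t"
proof -
  have "\<exists>\<xi>\<in>{0<..<x}. f x t - f 0 t = (*) (dx f \<xi> t) (x - 0)"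
  proof (rule mvt_simple[OF \<open>0 < x\<close>])
    fix \<xi> assume "0 \<le> \<xi>" "\<xi> \<le> x"
    then have "((\<lambda>\<xi>. f \<xi> t) has_real_derivative dx f \<xi> t) (at \<xi> within {0..x})"
      using dx_has_real_derivative[OF assms(1,2), of \<xi>] \<open>x \<le> 1\<close>
      by (auto intro: DERIV_subset)
    then show "((\<lambda>\<xi>. f \<xi> t) has_derivative (*) (dx f \<xi> t)) (at \<xi> within {0..x})"
      by (simp add: has_field_derivative_def)
  qed
  then obtain \<xi> where "0 < \<xi>" "\<xi> < x" "f x t = x * dx f \<xi> t"
    using assms(3) by (auto simp: mult.commute)
  then show thesis using that[of \<xi>] by simp
qed

lemma wall_quotient_tendsto:
  assumes "space_regular T f" "t \<in> {0..<T}" "f 0 t = 0"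
  shows "((\<lambda>x. f x t / x) \<longlongrightarrow> dx f 0 t) (at_right 0)"
  using dx_has_real_derivative[OF assms(1,2), of 0] assms(3)
  by (simp add: has_field_derivative_iff at_within_Icc_at_right)

text \<open>Dividing the right-hand side \<open>b u\<^sub>x - u b\<^sub>x\<close> of the transport equation by \<open>x\<close> turns it, by the
  mean value theorem, into a difference of two products whose values at \<open>x = 0\<close> coincide. On a
  compact time interval uniform continuity makes that difference small, uniformly in time.\<close>

lemma transport_term_uniformly_small:
  assumes u: "space_regular T u" "dirichlet T u"
    and b: "space_regular T b" "dirichlet T b"
    and "0 \<le> s" "r < T" "0 < e"
  obtains d where "0 < d"
    "\<And>x t. 0 < x \<Longrightarrow> x < d \<Longrightarrow> x \<le> 1 \<Longrightarrow> t \<in> {s..r} \<Longrightarrow>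
       \<bar>b x t * dx u x t - u x t * dx b x t\<bar> \<le> e * x"
proof -
  define K where "K = {0..1::real} \<times> {s..r}"
  (* A function of two independent points, because the mean value theorem evaluates the slopes of
     b and u at different distances from the wall. *)
  define P where "P = (\<lambda>(p, q). (\<lambda>(x, t). dx b x t) p * (\<lambda>(x, t). dx u x t) q)"
  have K: "K \<subseteq> {0..1} \<times> {0..<T}" using assms by (auto simp: K_def)
  have "continuous_on (K \<times> K) P"
    unfolding P_def case_prod_unfold
    by (intro continuous_intros
        continuous_on_compose2[OF dx_continuous_on[OF u(1), unfolded case_prod_unfold]]
        continuous_on_compose2[OF dx_continuous_on[OF b(1), unfolded case_prod_unfold]])
       (use K in auto)
  moreover have "compact (K \<times> K)" by (auto simp: K_def intro!: compact_Times)
  ultimately have "uniformly_continuous_on (K \<times> K) P"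
    by (rule compact_uniformly_continuous)
  then obtain d where d: "d > 0"
    "\<And>p q. p \<in> K \<times> K \<Longrightarrow> q \<in> K \<times> K \<Longrightarrow> dist q p < d \<Longrightarrow> dist (P q) (P p) < e"
    using \<open>0 < e\<close> unfolding uniformly_continuous_on_def by metis
  show thesis
  proof (rule that[of "d / 2"])
    fix x t assume x: "0 < x" "x < d / 2" "x \<le> 1" and t: "t \<in> {s..r}"
    have tT: "t \<in> {0..<T}" using t assms by auto
    obtain \<xi> where \<xi>: "0 \<le> \<xi>" "\<xi> \<le> x" "b x t = x * dx b \<xi> t"
      using wall_mean_value[OF b(1) tT _ x(1,3)] b(2) tT by (auto simp: dirichlet_def)
    obtain \<eta> where \<eta>: "0 \<le> \<eta>" "\<eta> \<le> x" "u x t = x * dx u \<eta> t"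
      using wall_mean_value[OF u(1) tT _ x(1,3)] u(2) tT by (auto simp: dirichlet_def)
    have "dist ((\<xi>, t), (x, t)) ((x, t), (\<eta>, t)) \<le> \<bar>\<xi> - x\<bar> + \<bar>x - \<eta>\<bar>"
      by (simp add: dist_Pair_Pair dist_real_def sqrt_sum_squares_le_sum_abs)
    also have "\<dots> < d" using x \<xi> \<eta> by auto
    finally have "dist (P ((\<xi>, t), (x, t))) (P ((x, t), (\<eta>, t))) < e"
      using x t \<xi> \<eta> by (intro d(2)) (auto simp: K_def)
    then have "\<bar>dx b \<xi> t * dx u x t - dx b x t * dx u \<eta> t\<bar> \<le> e"
      by (simp add: P_def dist_real_def)
    moreover have "b x t * dx u x t - u x t * dx b x t =
        x * (dx b \<xi> t * dx u x t - dx b x t * dx u \<eta> t)"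
      by (simp add: \<xi>(3) \<eta>(3) algebra_simps)
    ultimately show "\<bar>b x t * dx u x t - u x t * dx b x t\<bar> \<le> e * x"
      using x by (simp add: abs_mult mult.commute)
  qed (use d in simp)
qed

text \<open>By the previous bound, \<open>b / x\<close> changes in time at a rate below any given \<open>e\<close> once \<open>x\<close> is small;
  letting \<open>x\<close> tend to the wall transfers this to the slope, without differentiating the transport
  equation in \<open>x\<close>.\<close>

lemma wall_slope_constant:
  assumes u: "space_regular T u" "dirichlet T u"
    and b: "space_regular T b" "dirichlet T b" "time_regular T b"
    and transport: "\<And>x t. x \<in> {0..1} \<Longrightarrow> t \<in> {0<..<T} \<Longrightarrow>
      dt b x t + u x t * dx b x t = b x t * dx u x t"
    and t: "t \<in> {0<..<T}"
  shows "dx b 0 t = dx b 0 0"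
proof -
  have small: "\<bar>dx b 0 t - dx b 0 0\<bar> \<le> e" if e: "0 < e" for e
  proof -
    obtain d where d: "0 < d"
      "\<And>x \<tau>. 0 < x \<Longrightarrow> x < d \<Longrightarrow> x \<le> 1 \<Longrightarrow> \<tau> \<in> {0..t} \<Longrightarrow>
         \<bar>b x \<tau> * dx u x \<tau> - u x \<tau> * dx b x \<tau>\<bar> \<le> (e / t) * x"
      using transport_term_uniformly_small[OF u b(1,2), of 0 t "e / t"] t e by auto
    have *: "\<bar>b x t / x - b x 0 / x\<bar> \<le> e" if x: "0 < x" "x < d" "x \<le> 1" for x
    proof -
      have "continuous_on {0..<T} ((\<lambda>(x, t). b x t) \<circ> (\<lambda>t. (x, t)))"
        by (intro continuous_on_compose continuous_intros)
           (use b(1) x in \<open>auto simp: space_regular_def intro: continuous_on_subset\<close>)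
      then have "continuous_on {0..t} (b x)"
        by (rule continuous_on_subset[THEN continuous_on_eq]) (use t in auto)
      moreover have "(b x has_real_derivative dt b x \<tau>) (at \<tau>)" if "0 < \<tau>" "\<tau> < t" for \<tau>
        using dt_has_real_derivative[OF b(3), of x \<tau>] that x t by auto
      ultimately obtain \<tau> where \<tau>: "0 < \<tau>" "\<tau> < t" "b x t - b x 0 = (t - 0) * dt b x \<tau>"
        using MVT[of 0 t "b x"] t
        by (smt (verit, best) DERIV_unique greaterThanLessThan_iff real_differentiable_def)
      have "dt b x \<tau> = b x \<tau> * dx u x \<tau> - u x \<tau> * dx b x \<tau>"
        using transport[of x \<tau>] \<tau> t x by (simp add: algebra_simps)
      then have "\<bar>dt b x \<tau>\<bar> \<le> (e / t) * x"
        using d(2)[of x \<tau>] \<tau> x by simp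
      then have "\<bar>b x t - b x 0\<bar> \<le> t * ((e / t) * x)"
        unfolding \<tau>(3) using t by (simp add: abs_mult del: times_divide_eq_left)
      also have "\<dots> = e * x" using t by simp
      finally show ?thesis
        using x by (simp add: diff_divide_distrib[symmetric] divide_le_eq)
    qed
    have "((\<lambda>x. \<bar>b x t / x - b x 0 / x\<bar>) \<longlongrightarrow> \<bar>dx b 0 t - dx b 0 0\<bar>) (at_right 0)"
      using b(2) t by (intro tendsto_intros wall_quotient_tendsto[OF b(1)])
        (auto simp: dirichlet_def)
    moreover have "\<forall>\<^sub>F x in at_right 0. \<bar>b x t / x - b x 0 / x\<bar> \<le> e"
      unfolding eventually_at_right_field
      using d(1) * by (intro exI[of _ "min d 1"]) auto
    ultimately show ?thesis
      by (rule tendsto_upperbound) simp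
  qed
  have "\<bar>dx b 0 t - dx b 0 0\<bar> \<le> 0"
    by (rule field_le_epsilon) (use small in simp)
  then show ?thesis by simp
qed

text \<open>A Gronwall-type inequality: \<open>w\<close> times the integrating factor \<open>exp (- \<integral> c)\<close> is nondecreasing.\<close>

lemma linear_differential_inequality_nonneg:
  fixes w c w' :: "real \<Rightarrow> real"
  assumes w: "continuous_on {0..<T} w" and c: "continuous_on {0..<T} c"
    and der: "\<And>t. t \<in> {0<..<T} \<Longrightarrow> (w has_real_derivative w' t) (at t)"
    and ineq: "\<And>t. t \<in> {0<..<T} \<Longrightarrow> c t * w t \<le> w' t"
    and "0 \<le> w 0" and t: "t \<in> {0<..<T}"
  shows "0 \<le> w t"
proof -
  define C where "C s = integral {0..s} c" for s
  have c': "continuous_on {0..t} c" and w': "continuous_on {0..t} w"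
    using t by (auto intro: continuous_on_subset[OF c] continuous_on_subset[OF w])
  have C: "(C has_real_derivative c s) (at s within {0..t})" if "s \<in> {0..t}" for s
    unfolding C_def by (rule integral_has_real_derivative[OF c' that])
  have "w 0 * exp (- C 0) \<le> w t * exp (- C t)"
  proof (rule DERIV_nonneg_imp_increasing_open[where f = "\<lambda>s. w s * exp (- C s)"])
    show "0 \<le> t" using t by simp
    show "continuous_on {0..t} (\<lambda>s. w s * exp (- C s))"
      by (intro continuous_intros w' DERIV_continuous_on[OF C])
  next
    fix s assume s: "0 < s" "s < t"
    then have "at s within {0..t} = at s"
      by (simp add: at_within_Icc_at)
    then have "(C has_real_derivative c s) (at s)"
      using C[of s] s by simp
    moreover have "(w has_real_derivative w' s) (at s)" using der s t by simp
    ultimately have "((\<lambda>s. w s * exp (- C s)) has_real_derivative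
        (w' s - c s * w s) * exp (- C s)) (at s)"
      by (auto intro!: derivative_eq_intros simp: algebra_simps)
    moreover have "0 \<le> (w' s - c s * w s) * exp (- C s)"
      using ineq[of s] s t by simp
    ultimately show "\<exists>y. ((\<lambda>s. w s * exp (- C s)) has_real_derivative y) (at s) \<and> 0 \<le> y"
      by blast
  qed
  moreover have "0 \<le> w 0 * exp (- C 0)" using \<open>0 \<le> w 0\<close> by simp
  ultimately show ?thesis by (smt (verit) exp_gt_zero mult_neg_pos)
qed

lemma dx_cong_deriv01:
  assumes "\<And>\<xi>. \<xi> \<in> {0..1} \<Longrightarrow> f \<xi> t = g \<xi>" "x \<in> {0..1}"
  shows "dx f x t = deriv01 g x"
proof -
  have "\<And>D. ((\<lambda>\<xi>. f \<xi> t) has_vector_derivative D) (at x within {0..1}) \<longleftrightarrow>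
      (g has_vector_derivative D) (at x within {0..1})"
    using assms
    by (intro iffI) (auto elim!: has_vector_derivative_transform[rotated 2])
  then show ?thesis
    by (simp add: dx_def deriv01_def vector_derivative_def)
qed

theorem theorem6p1:
  fixes u b U :: "real \<Rightarrow> real \<Rightarrow> real" and u0 b0 :: "real \<Rightarrow> real"
  assumes "smooth01 u0" and "smooth01 b0"
    and "mhd_solution T_e u0 b0 u b"
    and "euler_solution T_e U_init U"
    and "filterlim (\<lambda>t. dx U 0 t) at_top (at_left T_e)"
    and "filterlim (\<lambda>t. L2norm01 (\<lambda>x. dx U x t)) at_top (at_left T_e)"
    and "deriv01 b0 0 = 0"
    and "deriv01 u0 0 \<ge> deriv01 U_init 0"
    and "(L2norm01 (deriv01 U_init))\<^sup>2 \<ge> (L2norm01 (deriv01 u0))\<^sup>2 - (L2norm01 (deriv01 b0))\<^sup>2"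
    and "\<forall>t\<in>{0<..<T_e}. (L2norm01 (\<lambda>x. dx U x t))\<^sup>2
           \<ge> (L2norm01 (\<lambda>x. dx u x t))\<^sup>2 - (L2norm01 (\<lambda>x. dx b x t))\<^sup>2"
  shows "filterlim (\<lambda>t. dx u 0 t) at_top (at_left T_e)"
proof -
  note mhd = assms(3)[unfolded mhd_solution_def]
  note euler = assms(4)[unfolded euler_solution_def]
  have u: "space_regular T_e u" "time_regular T_e (dx u)" "dirichlet T_e u"
    and b: "space_regular T_e b" "time_regular T_e b" "dirichlet T_e b"
    and U: "space_regular T_e U" "time_regular T_e (dx U)" "dirichlet T_e U"
    using mhd euler by auto
  have slope0: "dx b 0 t = 0" if t: "t \<in> {0<..<T_e}" for t
  proof -
    have "dx b 0 t = dx b 0 0"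
      using mhd by (intro wall_slope_constant[OF u(1,3) b(1,3,2) _ t]) blast+
    also have "\<dots> = deriv01 b0 0" using mhd by (intro dx_cong_deriv01) auto
    finally show ?thesis using assms(7) by simp
  qed
  have le: "dx U 0 t \<le> dx u 0 t" if t: "t \<in> {0<..<T_e}" for t
  proof -
    have "0 \<le> dx u 0 t - dx U 0 t"
    proof (rule linear_differential_inequality_nonneg
        [where w = "\<lambda>s. dx u 0 s - dx U 0 s" and c = "\<lambda>s. dx u 0 s + dx U 0 s"
          and w' = "\<lambda>s. dt (dx u) 0 s - dt (dx U) 0 s"])
      show "continuous_on {0..<T_e} (\<lambda>s. dx u 0 s - dx U 0 s)"
        by (intro continuous_intros dx_continuous_in_time u U) auto
      show "continuous_on {0..<T_e} (\<lambda>s. dx u 0 s + dx U 0 s)"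
        by (intro continuous_intros dx_continuous_in_time u U) auto
      have "dx u 0 0 = deriv01 u0 0" using mhd by (intro dx_cong_deriv01) auto
      moreover have "dx U 0 0 = deriv01 U_init 0" using euler by (intro dx_cong_deriv01) auto
      ultimately show "0 \<le> dx u 0 0 - dx U 0 0" using assms(8) by simp
    next
      fix s assume s: "s \<in> {0<..<T_e}"
      show "((\<lambda>s. dx u 0 s - dx U 0 s) has_real_derivative
          dt (dx u) 0 s - dt (dx U) 0 s) (at s)"
        by (intro derivative_intros dt_has_real_derivative[OF u(2)]
            dt_has_real_derivative[OF U(2)] s) auto
      have wall: "u 0 s = 0" "b 0 s = 0" "U 0 s = 0"
        using u(3) b(3) U(3) s by (auto simp: dirichlet_def)
      have "dt (dx u) 0 s = (dx u 0 s)\<^sup>2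
          + 2 * (L2norm01 (\<lambda>\<xi>. dx b \<xi> s))\<^sup>2 - 2 * (L2norm01 (\<lambda>\<xi>. dx u \<xi> s))\<^sup>2"
      proof -
        have "dt (dx u) 0 s + u 0 s * dx (dx u) 0 s =
          (dx u 0 s)\<^sup>2 - (dx b 0 s)\<^sup>2 + b 0 s * dx (dx b) 0 s
          + 2 * (L2norm01 (\<lambda>\<xi>. dx b \<xi> s))\<^sup>2 - 2 * (L2norm01 (\<lambda>\<xi>. dx u \<xi> s))\<^sup>2"
          using mhd s by auto
        then show ?thesis by (simp add: wall slope0[OF s])
      qed
      moreover have "dt (dx U) 0 s = (dx U 0 s)\<^sup>2 - 2 * (L2norm01 (\<lambda>\<xi>. dx U \<xi> s))\<^sup>2"
      proof -
        have "dt (dx U) 0 s + U 0 s * dx (dx U) 0 s =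
          (dx U 0 s)\<^sup>2 - 2 * (L2norm01 (\<lambda>\<xi>. dx U \<xi> s))\<^sup>2"
          using euler s by auto
        then show ?thesis by (simp add: wall)
      qed
      moreover have "(L2norm01 (\<lambda>x. dx U x s))\<^sup>2
          \<ge> (L2norm01 (\<lambda>x. dx u x s))\<^sup>2 - (L2norm01 (\<lambda>x. dx b x s))\<^sup>2"
        using assms(10) s by blast
      moreover have "(dx u 0 s + dx U 0 s) * (dx u 0 s - dx U 0 s) =
          (dx u 0 s)\<^sup>2 - (dx U 0 s)\<^sup>2"
        by (simp add: power2_eq_square algebra_simps)
      ultimately show "(dx u 0 s + dx U 0 s) * (dx u 0 s - dx U 0 s)
          \<le> dt (dx u) 0 s - dt (dx U) 0 s"
        by linarith
    qed (rule t)
    then show ?thesis by simp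
  qed
  have "0 < T_e" by (simp add: T_e_def)
  then have "\<forall>\<^sub>F t in at_left T_e. t \<in> {0<..<T_e}"
    by (rule eventually_at_left_real)
  then have "\<forall>\<^sub>F t in at_left T_e. dx U 0 t \<le> dx u 0 t"
    by eventually_elim (rule le)
  with assms(5) show ?thesis
    by (rule filterlim_at_top_mono)
qed

end
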